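(* Let $\rho\in\mathbf{C}$. Every solution $P:[1,\infty)\to\mathbf{C}$, defined on all of $[1,\infty)$, of the ordinary differential equation $$(1-x^2)P''(x)-2xP'(x)+\rho(\rho+1)P(x)=0$$ is a complex scalar multiple of the function $$P_\rho(x)=\frac{1}{2\pi}\int_0^{2\pi}\bigl(x+\sqrt{x^2-1}\,\cos\theta\bigr)^\rho\,d\theta\qquad(x\in[1,\infty)).$$
   Context: For $t>0$ and $\rho\in\mathbf{C}$, $t^\rho=e^{\rho\log t}$ with real logarithm; note $x+\sqrt{x^2-1}\cos\theta>0$ for $x\ge 1$. A solution defined on $[1,\infty)$ means a function that is twice continuously differentiable on $[1,\infty)$ (one-sided derivatives at the endpoint $1$) and satisfies the equation at every $x\in[1,\infty)$. *)

theory Defs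
  imports "HOL-Analysis.Analysis"
begin

text \<open>
  Twice continuously differentiable on \<open>[1,\<infinity>)\<close>: at the endpoint \<open>1\<close> the derivative within
  \<open>{1..}\<close> is one-sided, at every other point of \<open>{1..}\<close> it is the ordinary derivative. The values
  of \<open>P\<close> at arguments below \<open>1\<close> play no role.
\<close>

definition legendre_solution :: "complex \<Rightarrow> (real \<Rightarrow> complex) \<Rightarrow> bool" where
  "legendre_solution \<rho> P \<longleftrightarrow>
     (\<exists>P' P'' :: real \<Rightarrow> complex.
        (\<forall>x\<in>{1..}. (P has_vector_derivative P' x) (at x within {1..})) \<and>
        (\<forall>x\<in>{1..}. (P' has_vector_derivative P'' x) (at x within {1..})) \<and>
        continuous_on {1..} P'' \<and>
        (\<forall>x\<in>{1..}. complex_of_real (1 - x\<^sup>2) * P'' x - complex_of_real (2 * x) * P' x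
                      + \<rho> * (\<rho> + 1) * P x = 0))"

text \<open>
  The power \<open>t\<^sup>\<rho>\<close> of \<open>t = x + sqrt (x\<^sup>2 - 1) * cos \<theta>\<close> is \<open>exp (\<rho> * ln t)\<close> with the real logarithm;
  for \<open>x \<ge> 1\<close> this \<open>t\<close> is positive. The function is meaningful only for \<open>x \<ge> 1\<close>.
\<close>

definition legendre_function :: "complex \<Rightarrow> real \<Rightarrow> complex" where
  "legendre_function \<rho> x =
     complex_of_real (1 / (2 * pi)) *
     integral {0..2 * pi}
       (\<lambda>\<theta>. exp (\<rho> * complex_of_real (ln (x + sqrt (x\<^sup>2 - 1) * cos \<theta>))))"

end

theory Submission
  imports Defs
begin

text \<open>
  Substitute \<open>x = cosh s\<close>. With \<open>\<mu> = \<rho> (\<rho> + 1)\<close> the equation becomes \<open>(sinh s V')' = \<mu> sinh s V\<close>,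
  whose coefficients are smooth on \<open>[0,\<infinity>)\<close>. A solution with \<open>V 0 = 0\<close> vanishes: if \<open>M\<close> is the
  maximum of \<open>|V s| exp (- k s)\<close> on an interval \<open>[0,T]\<close>, then integrating the equation twice gives
  \<open>M \<le> |\<mu>| M / k\<^sup>2\<close>, because \<open>sinh\<close> is increasing. Hence a solution is determined by its value
  at \<open>0\<close>. Finally, for \<open>t = cosh s + sinh s cos \<theta>\<close> the function \<open>f = t\<^sup>\<rho>\<close> satisfies
  \<open>\<partial>\<^sub>s (sinh s \<partial>\<^sub>s f) = \<mu> sinh s f + \<partial>\<^sub>\<theta> (\<rho> t\<^sup>\<rho>\<^sup>-\<^sup>1 sin \<theta>)\<close>, and the last term integrates
  to zero over a period.
\<close>

subsection \<open>Uniqueness\<close>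

text \<open>This is the radial part of \<open>\<Delta> V = \<mu> V\<close> on the hyperbolic plane, multiplied by \<open>sinh s\<close>.\<close>

definition radial_eigenfunction :: "complex \<Rightarrow> (real \<Rightarrow> complex) \<Rightarrow> bool" where
  "radial_eigenfunction \<mu> V \<longleftrightarrow>
     (\<exists>V'. (\<forall>s\<ge>0. (V has_vector_derivative V' s) (at s within {0..})) \<and>
           (\<forall>s\<ge>0. ((\<lambda>s. of_real (sinh s) * V' s) has_vector_derivative \<mu> * of_real (sinh s) * V s)
                     (at s within {0..})))"

lemma radial_eigenfunction_diff_scaled:
  assumes "radial_eigenfunction \<mu> V" "radial_eigenfunction \<mu> W"
  shows "radial_eigenfunction \<mu> (\<lambda>s. V s - c * W s)"
proof -
  obtain V' where V': "\<And>s. s \<ge> 0 \<Longrightarrow> (V has_vector_derivative V' s) (at s within {0..})"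
      "\<And>s. s \<ge> 0 \<Longrightarrow> ((\<lambda>s. of_real (sinh s) * V' s) has_vector_derivative
         \<mu> * of_real (sinh s) * V s) (at s within {0..})"
    using assms(1) unfolding radial_eigenfunction_def by blast
  obtain W' where W': "\<And>s. s \<ge> 0 \<Longrightarrow> (W has_vector_derivative W' s) (at s within {0..})"
      "\<And>s. s \<ge> 0 \<Longrightarrow> ((\<lambda>s. of_real (sinh s) * W' s) has_vector_derivative
         \<mu> * of_real (sinh s) * W s) (at s within {0..})"
    using assms(2) unfolding radial_eigenfunction_def by blast
  have "((\<lambda>s. V s - c * W s) has_vector_derivative V' s - c * W' s) (at s within {0..})"
    if "s \<ge> 0" for s
    using V'(1) W'(1) that
    by (intro has_vector_derivative_diff has_vector_derivative_mult_right) auto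
  moreover have "((\<lambda>s. of_real (sinh s) * (V' s - c * W' s)) has_vector_derivative
      \<mu> * of_real (sinh s) * (V s - c * W s)) (at s within {0..})" if "s \<ge> 0" for s
    using has_vector_derivative_diff
      [OF V'(2)[OF that] has_vector_derivative_mult_right[OF W'(2)[OF that], of c]]
    by (simp add: algebra_simps)
  ultimately show ?thesis
    unfolding radial_eigenfunction_def by (intro exI[of _ "\<lambda>s. V' s - c * W' s"]) simp
qed

text \<open>Mean value inequality with comparison function \<open>A / k * exp (k * r)\<close>:
  integrating against an exponential weight gains a factor \<open>1 / k\<close>. The bound on
  \<open>F'\<close> is asked only for \<open>r > 0\<close>, since below the bound on
  \<open>V'\<close> comes from a division by \<open>sinh\<close>.\<close>

lemma norm_le_exp_if_derivative_le_exp: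
  fixes F F' :: "real \<Rightarrow> complex"
  assumes der: "\<And>r. 0 \<le> r \<Longrightarrow> (F has_vector_derivative F' r) (at r within {0..})"
    and bnd: "\<And>r. 0 < r \<Longrightarrow> r \<le> s \<Longrightarrow> norm (F' r) \<le> A * exp (k * r)"
    and "F 0 = 0" "0 < k" "0 \<le> A" "0 < s"
  shows "norm (F s) \<le> A / k * exp (k * s)"
proof -
  have "norm (F s - F 0) \<le> A / k * exp (k * s) - A / k * exp (k * 0)"
  proof (rule differentiable_bound_general[where f' = F' and \<phi>' = "\<lambda>r. A * exp (k * r)"])
    have "continuous_on {0..} F"
      using der by (auto simp: continuous_on_eq_continuous_within
          intro!: has_vector_derivative_continuous)
    then show "continuous_on {0..s} F"
      by (rule continuous_on_subset) auto
    show "(F has_vector_derivative F' x) (at x)" if "0 < x" "x < s" for x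
    proof -
      have "(F has_vector_derivative F' x) (at x within {0<..})"
        using der[of x] that by (auto intro: has_vector_derivative_within_subset)
      then show ?thesis
        using that by (simp add: at_within_open[of x "{0<..}"])
    qed
    show "((\<lambda>r. A / k * exp (k * r)) has_vector_derivative A * exp (k * x)) (at x)" for x
      unfolding has_real_derivative_iff_has_vector_derivative[symmetric]
      using \<open>0 < k\<close> by (auto intro!: derivative_eq_intros)
  qed (use assms in \<open>auto intro!: continuous_intros\<close>)
  also have "\<dots> \<le> A / k * exp (k * s)"
    using \<open>0 < k\<close> \<open>0 \<le> A\<close> by simp
  finally show ?thesis
    using \<open>F 0 = 0\<close> by simp
qed

text \<open>One initial value suffices for this second order equation because the coefficient
  \<open>sinh\<close> vanishes at \<open>0\<close>: \<open>sinh s * V' s\<close> starts at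
  \<open>0\<close> whatever \<open>V' 0\<close> is, so both integrations start from zero.\<close>

lemma radial_eigenfunction_eq_0:
  assumes V: "radial_eigenfunction \<mu> V" and V0: "V 0 = 0" and "0 \<le> T"
  shows "V T = 0"
proof -
  obtain V' where V': "\<And>s. s \<ge> 0 \<Longrightarrow> (V has_vector_derivative V' s) (at s within {0..})"
    and V'': "\<And>s. s \<ge> 0 \<Longrightarrow> ((\<lambda>s. of_real (sinh s) * V' s) has_vector_derivative
         \<mu> * of_real (sinh s) * V s) (at s within {0..})"
    using V unfolding radial_eigenfunction_def by blast
  \<comment> \<open>Any \<open>k\<close> with \<open>k * k > norm \<mu>\<close> makes the two
    integrations together a strict contraction.\<close>
  define k where "k = norm \<mu> + 1"
  have "k > 0"
    by (simp add: k_def add_nonneg_pos)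
  have "norm \<mu> < k * k"
    by (simp add: k_def algebra_simps add_pos_nonneg)
  with \<open>k > 0\<close> have k: "norm \<mu> / k / k < 1"
    by (simp add: divide_less_eq)
  have contV: "continuous_on {0..} V"
    using V' by (auto simp: continuous_on_eq_continuous_within
        intro!: has_vector_derivative_continuous)
  have "continuous_on {0..T} (\<lambda>s. norm (V s) * exp (- k * s))"
    by (intro continuous_intros continuous_on_subset[OF contV]) auto
  then obtain m where m: "0 \<le> m" "m \<le> T"
    and max: "\<And>s. 0 \<le> s \<Longrightarrow> s \<le> T \<Longrightarrow> norm (V s) * exp (- k * s) \<le> norm (V m) * exp (- k * m)"
    using continuous_attains_sup[of "{0..T}" "\<lambda>s. norm (V s) * exp (- k * s)"] \<open>0 \<le> T\<close> by auto
  define M where "M = norm (V m) * exp (- k * m)"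
  have M: "norm (V s) \<le> M * exp (k * s)" if "0 \<le> s" "s \<le> T" for s
    using max[OF that] by (simp add: M_def exp_minus divide_simps)
  have "M \<ge> 0" by (simp add: M_def)
  \<comment> \<open>First integration. On \<open>[0,s]\<close> the weight \<open>sinh r\<close> is
    bounded by its end value \<open>sinh s\<close>, and this constant cancels against the factor of
    \<open>V' s\<close>, so no singularity at \<open>0\<close> is left.\<close>
  have V'_bound: "norm (V' s) \<le> norm \<mu> * M / k * exp (k * s)" if "0 < s" "s \<le> T" for s
  proof -
    have "norm (of_real (sinh s) * V' s) \<le> (norm \<mu> * sinh s * M) / k * exp (k * s)"
    proof (rule norm_le_exp_if_derivative_le_exp[OF V''])
      fix r assume r: "0 < r" "r \<le> s"
      have "norm (\<mu> * of_real (sinh r) * V r) = norm \<mu> * sinh r * norm (V r)"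
        using r by (simp add: norm_mult)
      also have "\<dots> \<le> norm \<mu> * sinh s * (M * exp (k * r))"
        using r that M[of r] by (intro mult_mono) auto
      finally show "norm (\<mu> * of_real (sinh r) * V r) \<le> norm \<mu> * sinh s * M * exp (k * r)"
        by (simp add: mult.assoc)
    qed (use \<open>k > 0\<close> \<open>M \<ge> 0\<close> that in auto)
    then have "sinh s * norm (V' s) \<le> sinh s * (norm \<mu> * M / k * exp (k * s))"
      using that by (simp add: norm_mult mult_ac)
    then show ?thesis
      using that by (simp add: mult_le_cancel_left_pos del: times_divide_eq_left times_divide_eq_right)
  qed
  have "V m = 0"
  \<comment> \<open>Second integration, evaluated at the maximum point \<open>m\<close>. It yields
    \<open>M \<le> norm \<mu> / k / k * M\<close> with a factor below \<open>1\<close>, hence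
    \<open>M = 0\<close>. The integration bound needs \<open>m > 0\<close>.\<close>
  proof (cases "m = 0")
    case False
    then have "norm (V m) \<le> norm \<mu> * M / k / k * exp (k * m)"
      using m \<open>k > 0\<close> \<open>M \<ge> 0\<close>
      by (intro norm_le_exp_if_derivative_le_exp[OF V'] V'_bound V0) auto
    then have "M \<le> norm \<mu> * M / k / k * exp (k * m) * exp (- k * m)"
      unfolding M_def by (rule mult_right_mono) simp
    then have "M \<le> norm \<mu> / k / k * M"
      by (simp add: mult.assoc flip: exp_add)
    then have "M \<le> 0"
      using k \<open>M \<ge> 0\<close> mult_strict_right_mono[OF k, of M] by fastforce
    then show ?thesis
      by (simp add: M_def mult_le_0_iff)
  qed (simp add: V0)
  then have "M = 0" by (simp add: M_def)
  then show ?thesis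
    using M[of T] \<open>0 \<le> T\<close> by simp
qed

subsection \<open>The integral\<close>

text \<open>Written with the real logarithm, in the same form as the integrand of
  \<open>legendre_function\<close>.\<close>

definition cpow :: "complex \<Rightarrow> real \<Rightarrow> complex" where
  "cpow \<sigma> t = exp (\<sigma> * of_real (ln t))"

lemma cpow_add: "cpow (\<sigma> + \<tau>) t = cpow \<sigma> t * cpow \<tau> t"
  by (simp add: cpow_def ring_distribs exp_add)

lemma cpow_1: "t > 0 \<Longrightarrow> cpow 1 t = of_real t"
  by (simp add: cpow_def exp_of_real)

lemma cpow_eq_mult_cpow_diff_1: "t > 0 \<Longrightarrow> cpow \<sigma> t = of_real t * cpow (\<sigma> - 1) t"
  using cpow_add[of "\<sigma> - 1" 1 t] by (simp add: cpow_1)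

text \<open>The logarithm contributes \<open>f' / f x\<close>; absorbing the denominator into the
  exponent gives a form that can be differentiated again by the same rule.\<close>

lemma has_vector_derivative_cpow:
  assumes "(f has_real_derivative f') (at x)" "f x > 0"
  shows "((\<lambda>x. cpow \<sigma> (f x)) has_vector_derivative \<sigma> * of_real f' * cpow (\<sigma> - 1) (f x)) (at x)"
proof -
  have "((\<lambda>x. ln (f x)) has_real_derivative f' / f x) (at x)"
    using assms by (auto intro!: derivative_eq_intros)
  then have "((\<lambda>x. \<sigma> * of_real (ln (f x))) has_vector_derivative \<sigma> * of_real (f' / f x)) (at x)"
    by (intro has_vector_derivative_mult_right has_vector_derivative_of_real)
       (simp add: has_real_derivative_iff_has_vector_derivative)
  then have "(exp \<circ> (\<lambda>x. \<sigma> * of_real (ln (f x))) has_vector_derivative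
      \<sigma> * of_real (f' / f x) * cpow \<sigma> (f x)) (at x)"
    unfolding cpow_def
    by (intro field_vector_diff_chain_at) (auto intro!: derivative_eq_intros)
  then show ?thesis
    using assms(2) cpow_eq_mult_cpow_diff_1[OF assms(2), of \<sigma>]
    by (simp add: o_def mult.assoc flip: cpow_def)
qed

lemma continuous_on_cpow [continuous_intros]:
  assumes "continuous_on S f" "\<And>x. x \<in> S \<Longrightarrow> f x > 0"
  shows "continuous_on S (\<lambda>x. cpow \<sigma> (f x))"
  unfolding cpow_def using assms by (intro continuous_intros) (auto simp: less_imp_neq[symmetric])

lemma cosh_sinh_cos_pos: "cosh s + sinh s * cos \<theta> > (0 :: real)"
proof -
  have "\<bar>sinh s * cos \<theta>\<bar> \<le> \<bar>sinh s\<bar>"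
    by (simp add: abs_mult mult_left_le)
  also have "\<dots> < cosh s"
    using sinh_less_cosh_real[of "\<bar>s\<bar>"] by simp
  finally show ?thesis by linarith
qed

text \<open>In the variable \<open>s\<close> the root \<open>sqrt (x\<^sup>2 - 1)\<close>, not
  differentiable at \<open>x = 1\<close>, becomes \<open>sinh s\<close>, and the integrand is smooth
  for all real \<open>s\<close>.\<close>

definition laplace_integral :: "complex \<Rightarrow> real \<Rightarrow> complex" where
  "laplace_integral \<rho> s = integral {0..2 * pi} (\<lambda>\<theta>. cpow \<rho> (cosh s + sinh s * cos \<theta>))"

lemma legendre_function_cosh:
  assumes "s \<ge> 0"
  shows "legendre_function \<rho> (cosh s) = of_real (1 / (2 * pi)) * laplace_integral \<rho> s"
proof -
  have "sqrt ((cosh s)\<^sup>2 - 1) = sinh s"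
    using assms by (simp add: sinh_square_eq[symmetric])
  then show ?thesis
    by (simp add: legendre_function_def laplace_integral_def cpow_def)
qed

lemma laplace_integral_0: "laplace_integral \<rho> 0 = of_real (2 * pi)"
  by (simp add: laplace_integral_def cpow_def scaleR_conv_of_real)

lemma radial_eigenfunction_laplace_integral:
  "radial_eigenfunction (\<rho> * (\<rho> + 1)) (laplace_integral \<rho>)"
proof -
  \<comment> \<open>\<open>t'\<close> is the \<open>s\<close>-derivative of \<open>t\<close>, and
    differentiating once more returns \<open>t\<close>.\<close>
  define t where "t s \<theta> = cosh s + sinh s * cos \<theta>" for s \<theta> :: real
  define t' where "t' s \<theta> = sinh s + cosh s * cos \<theta>" for s \<theta> :: real
  have t_pos: "t s \<theta> > 0" for s \<theta>
    unfolding t_def by (rule cosh_sinh_cos_pos)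
  have t_deriv: "((\<lambda>s. t s \<theta>) has_real_derivative t' s \<theta>) (at s)" for s \<theta>
    unfolding t_def t'_def by (auto intro!: derivative_eq_intros)
  have t'_deriv: "((\<lambda>s. t' s \<theta>) has_real_derivative t s \<theta>) (at s)" for s \<theta>
    unfolding t_def t'_def by (auto intro!: derivative_eq_intros)
  have [continuous_intros]: "continuous_on S (\<lambda>x. t (f x) (g x))" "continuous_on S (\<lambda>x. t' (f x) (g x))"
    if "continuous_on S f" "continuous_on S g"
    for S :: "'b :: t2_space set" and f g
    unfolding t_def t'_def using that by (auto intro!: continuous_intros)
  \<comment> \<open>With \<open>f = cpow \<rho> (t s \<theta>)\<close>, \<open>G\<close> is the
    \<open>s\<close>-derivative of \<open>f\<close>, and \<open>H\<close> is that of
    \<open>sinh s * G s \<theta>\<close>. Both are jointly continuous, so each differentiation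
    passes under the integral.\<close>
  define G where "G s \<theta> = \<rho> * of_real (t' s \<theta>) * cpow (\<rho> - 1) (t s \<theta>)" for s \<theta>
  define H where "H s \<theta> = of_real (cosh s) * G s \<theta> + of_real (sinh s) *
      (\<rho> * of_real (t s \<theta>) * cpow (\<rho> - 1) (t s \<theta>)
        + \<rho> * (\<rho> - 1) * of_real (t' s \<theta>) ^ 2 * cpow (\<rho> - 2) (t s \<theta>))" for s \<theta>
  have G: "(laplace_integral \<rho> has_vector_derivative integral {0..2 * pi} (G s)) (at s)" for s
  proof -
    have "((\<lambda>s. integral (cbox 0 (2 * pi)) (\<lambda>\<theta>. cpow \<rho> (t s \<theta>))) has_vector_derivative
        integral (cbox 0 (2 * pi)) (G s)) (at s within UNIV)"
    proof (rule leibniz_rule_vector_derivative)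
      show "((\<lambda>x. cpow \<rho> (t x \<theta>)) has_vector_derivative G x \<theta>) (at x within UNIV)" for x \<theta>
        using has_vector_derivative_cpow[OF t_deriv t_pos, of \<rho>] by (simp add: G_def)
      show "(\<lambda>\<theta>. cpow \<rho> (t x \<theta>)) integrable_on cbox 0 (2 * pi)" for x
        by (intro integrable_continuous continuous_intros t_pos)
      show "continuous_on (UNIV \<times> cbox 0 (2 * pi)) (\<lambda>(x, t). G x t)"
        unfolding G_def case_prod_unfold by (intro continuous_intros t_pos)
    qed auto
    then show ?thesis
      by (simp add: laplace_integral_def[abs_def] t_def)
  qed
  have H: "((\<lambda>s. of_real (sinh s) * integral {0..2 * pi} (G s)) has_vector_derivative
      integral {0..2 * pi} (H s)) (at s)" for s
  proof -
    have "((\<lambda>s. integral (cbox 0 (2 * pi)) (\<lambda>\<theta>. of_real (sinh s) * G s \<theta>)) has_vector_derivative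
        integral (cbox 0 (2 * pi)) (H s)) (at s within UNIV)"
    proof (rule leibniz_rule_vector_derivative)
      show "((\<lambda>x. of_real (sinh x) * G x \<theta>) has_vector_derivative H x \<theta>) (at x within UNIV)" for x \<theta>
      proof -
        have 1: "((\<lambda>x. complex_of_real (sinh x)) has_vector_derivative of_real (cosh x)) (at x)"
          by (intro has_vector_derivative_of_real)
             (auto simp flip: has_real_derivative_iff_has_vector_derivative intro!: derivative_eq_intros)
        have 2: "((\<lambda>x. complex_of_real (t' x \<theta>)) has_vector_derivative of_real (t x \<theta>)) (at x)"
          using t'_deriv
          by (intro has_vector_derivative_of_real)
             (auto simp flip: has_real_derivative_iff_has_vector_derivative)
        note 3 = has_vector_derivative_cpow[OF t_deriv[of \<theta> x] t_pos, of "\<rho> - 1"]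
        show ?thesis
          unfolding G_def
          by (rule has_vector_derivative_eq_rhs[OF has_vector_derivative_mult[OF 1
                has_vector_derivative_mult[OF has_vector_derivative_mult_right[OF 2] 3]]])
             (simp add: H_def G_def algebra_simps power2_eq_square)
      qed
      show "(\<lambda>\<theta>. of_real (sinh x) * G x \<theta>) integrable_on cbox 0 (2 * pi)" for x
        unfolding G_def by (intro integrable_continuous continuous_intros t_pos)
      show "continuous_on (UNIV \<times> cbox 0 (2 * pi)) (\<lambda>(x, t). H x t)"
        unfolding G_def H_def case_prod_unfold by (intro continuous_intros t_pos)
    qed auto
    then show ?thesis by simp
  qed
  have "integral {0..2 * pi} (H s) = \<rho> * (\<rho> + 1) * of_real (sinh s) * laplace_integral \<rho> s" for s
  proof -
    have "(\<lambda>\<theta>. cpow \<rho> (t s \<theta>)) integrable_on {0..2 * pi}"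
      by (intro integrable_continuous_interval continuous_intros t_pos)
    then have f: "((\<lambda>\<theta>. \<rho> * (\<rho> + 1) * of_real (sinh s) * cpow \<rho> (t s \<theta>)) has_integral
        \<rho> * (\<rho> + 1) * of_real (sinh s) * laplace_integral \<rho> s) {0..2 * pi}"
      unfolding laplace_integral_def t_def[symmetric]
      by (intro has_integral_mult_right integrable_integral)
    \<comment> \<open>The integrand is the \<open>\<theta>\<close>-derivative of
      \<open>\<rho> * sin \<theta> * cpow (\<rho> - 1) (t s \<theta>)\<close>, whose boundary values
      vanish with \<open>sin 0\<close> and \<open>sin (2 * pi)\<close>.\<close>
    have "((\<lambda>\<theta>. H s \<theta> - \<rho> * (\<rho> + 1) * of_real (sinh s) * cpow \<rho> (t s \<theta>)) has_integral
        \<rho> * of_real (sin (2 * pi)) * cpow (\<rho> - 1) (t s (2 * pi))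
        - \<rho> * of_real (sin 0) * cpow (\<rho> - 1) (t s 0)) {0..2 * pi}"
    proof (rule fundamental_theorem_of_calculus)
      fix \<theta>
      have 1: "((\<lambda>\<theta>. complex_of_real (sin \<theta>)) has_vector_derivative of_real (cos \<theta>)) (at \<theta>)"
        by (intro has_vector_derivative_of_real)
           (auto simp flip: has_real_derivative_iff_has_vector_derivative intro!: derivative_eq_intros)
      have "((\<lambda>\<theta>. t s \<theta>) has_real_derivative - sinh s * sin \<theta>) (at \<theta>)"
        unfolding t_def by (auto intro!: derivative_eq_intros)
      note 2 = has_vector_derivative_cpow[OF this t_pos, of "\<rho> - 1"]
      \<comment> \<open>All powers of \<open>t\<close> that occur are \<open>q\<close> times
        \<open>1\<close>, \<open>t\<close> or \<open>t ^ 2\<close>, so the claim reduces to a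
        polynomial identity modulo \<open>CS\<close> and \<open>cz\<close>.\<close>
      define q where "q = cpow (\<rho> - 2) (t s \<theta>)"
      have q1: "cpow (\<rho> - 1) (t s \<theta>) = of_real (t s \<theta>) * q"
        using cpow_eq_mult_cpow_diff_1[OF t_pos, of "\<rho> - 1" s \<theta>] by (simp add: q_def)
      have q0: "cpow \<rho> (t s \<theta>) = of_real (t s \<theta>) ^ 2 * q"
        using cpow_eq_mult_cpow_diff_1[OF t_pos, of \<rho> s \<theta>] q1 by (simp add: power2_eq_square)
      define C S c z :: complex where "C = of_real (cosh s)" and "S = of_real (sinh s)"
        and "c = of_real (cos \<theta>)" and "z = of_real (sin \<theta>)"
      have CS: "C ^ 2 = S ^ 2 + 1" and cz: "z ^ 2 = 1 - c ^ 2"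
        unfolding C_def S_def c_def z_def
        by (simp_all add: cosh_square_eq sin_squared_eq flip: of_real_power)
      have tt: "of_real (t s \<theta>) = C + S * c" "of_real (t' s \<theta>) = S + C * c"
        by (simp_all add: t_def t'_def C_def S_def c_def)
      \<comment> \<open>In terms of \<open>t\<close>, \<open>e1\<close> says
        \<open>t' ^ 2 = t ^ 2 - sin \<theta> ^ 2\<close> and \<open>e2\<close> says
        \<open>cosh s * t' = sinh s * t + cos \<theta>\<close>.\<close>
      have e1: "(S + C * c) ^ 2 = (C + S * c) ^ 2 - z ^ 2"
        unfolding cz power2_sum power_mult_distrib CS by (simp add: algebra_simps)
      have "C * (S + C * c) = C * S + C ^ 2 * c"
        by (simp add: algebra_simps power2_eq_square)
      then have e2: "C * (S + C * c) = S * (C + S * c) + c"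
        unfolding CS by (simp add: algebra_simps power2_eq_square)
      \<comment> \<open>The terms with \<open>S * t ^ 2 * q\<close> cancel because \<open>\<rho> +
        \<rho> + \<rho> * (\<rho> - 1) = \<rho> * (\<rho> + 1)\<close>; the terms with
        \<open>z ^ 2\<close> and \<open>c\<close> remain.\<close>
      have "\<rho> * z * ((\<rho> - 1) * (- S * z) * q) + \<rho> * c * ((C + S * c) * q) =
          \<rho> * (S * (C + S * c) + c) * ((C + S * c) * q)
          + S * (\<rho> * (C + S * c) * ((C + S * c) * q)
            + \<rho> * (\<rho> - 1) * ((C + S * c) ^ 2 - z ^ 2) * q)
          - \<rho> * (\<rho> + 1) * S * ((C + S * c) ^ 2 * q)"
        by (simp add: algebra_simps power2_eq_square)
      also have "\<dots> = C * (\<rho> * (S + C * c) * ((C + S * c) * q))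
          + S * (\<rho> * (C + S * c) * ((C + S * c) * q) + \<rho> * (\<rho> - 1) * (S + C * c) ^ 2 * q)
          - \<rho> * (\<rho> + 1) * S * ((C + S * c) ^ 2 * q)"
        unfolding e1[symmetric] e2[symmetric] by (simp add: mult_ac)
      also have "\<dots> = H s \<theta> - \<rho> * (\<rho> + 1) * of_real (sinh s) * cpow \<rho> (t s \<theta>)"
        unfolding H_def G_def q0 q1 q_def[symmetric] tt C_def[symmetric] S_def[symmetric] ..
      finally have eq: "\<rho> * z * ((\<rho> - 1) * (- S * z) * q) + \<rho> * c * ((C + S * c) * q) = \<dots>" .
      have "\<rho> * of_real (sin \<theta>) * ((\<rho> - 1) * of_real (- sinh s * sin \<theta>) * cpow (\<rho> - 1 - 1) (t s \<theta>))
          + \<rho> * of_real (cos \<theta>) * cpow (\<rho> - 1) (t s \<theta>) =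
          \<rho> * z * ((\<rho> - 1) * (- S * z) * q) + \<rho> * c * ((C + S * c) * q)"
        unfolding q1 tt z_def c_def S_def q_def by simp
      note rhs = this[unfolded eq]
      show "((\<lambda>\<theta>. \<rho> * of_real (sin \<theta>) * cpow (\<rho> - 1) (t s \<theta>)) has_vector_derivative
          H s \<theta> - \<rho> * (\<rho> + 1) * of_real (sinh s) * cpow \<rho> (t s \<theta>)) (at \<theta> within {0..2 * pi})"
        by (rule has_vector_derivative_at_within[OF has_vector_derivative_eq_rhs
              [OF has_vector_derivative_mult[OF has_vector_derivative_mult_right[OF 1] 2] rhs]])
    qed auto
    from has_integral_add[OF f this]
    have "(H s has_integral \<rho> * (\<rho> + 1) * of_real (sinh s) * laplace_integral \<rho> s) {0..2 * pi}"
      by simp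
    then show ?thesis
      by (rule integral_unique)
  qed
  with H have "((\<lambda>s. of_real (sinh s) * integral {0..2 * pi} (G s)) has_vector_derivative
      \<rho> * (\<rho> + 1) * of_real (sinh s) * laplace_integral \<rho> s) (at s)" for s
    by simp
  with G show ?thesis
    unfolding radial_eigenfunction_def
    by (intro exI[of _ "\<lambda>s. integral {0..2 * pi} (G s)"])
       (blast intro: has_vector_derivative_at_within)
qed

section \<open>The Legendre equation in the variable \<open>s\<close>, and the conclusion\<close>

lemma radial_eigenfunction_legendre_solution:
  assumes "legendre_solution \<rho> P"
  shows "radial_eigenfunction (\<rho> * (\<rho> + 1)) (\<lambda>s. P (cosh s))"
proof -
  obtain P' P'' where P': "\<And>x. x \<ge> 1 \<Longrightarrow> (P has_vector_derivative P' x) (at x within {1..})"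
    and P'': "\<And>x. x \<ge> 1 \<Longrightarrow> (P' has_vector_derivative P'' x) (at x within {1..})"
    and eq: "\<And>x. x \<ge> 1 \<Longrightarrow> complex_of_real (1 - x\<^sup>2) * P'' x - complex_of_real (2 * x) * P' x
                      + \<rho> * (\<rho> + 1) * P x = 0"
    using assms unfolding legendre_solution_def atLeast_iff Ball_def by blast
  \<comment> \<open>Since \<open>cosh\<close> maps \<open>{0..}\<close> into \<open>{1..}\<close>,
    the one-sided derivative at \<open>1\<close> is enough for the chain rule at
    \<open>s = 0\<close>.\<close>
  have cosh: "((\<lambda>s. f (cosh s)) has_vector_derivative of_real (sinh s) * f') (at s within {0..})"
    if "(f has_vector_derivative f') (at (cosh s) within {1..})" for f :: "real \<Rightarrow> complex" and f' s
  proof -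
    have "(f has_vector_derivative f') (at (cosh s) within cosh ` {0..})"
      by (rule has_vector_derivative_within_subset[OF that]) (auto simp: cosh_real_ge_1)
    moreover have "(cosh has_vector_derivative sinh s) (at s within {0..})"
      unfolding has_real_derivative_iff_has_vector_derivative[symmetric]
      by (auto intro!: derivative_eq_intros)
    ultimately show ?thesis
      using vector_diff_chain_within[of cosh "sinh s" s "{0..}" f f']
      by (simp add: o_def scaleR_conv_of_real)
  qed
  \<comment> \<open>One factor \<open>sinh s\<close> is the weight, the other comes from the chain
    rule. The product rule gives \<open>S * (S ^ 2 * P'' + 2 * C * P')\<close>, and
    \<open>1 - x ^ 2 = - S ^ 2\<close> turns the bracket into the Legendre equation.\<close>
  have "((\<lambda>s. of_real (sinh s) * (of_real (sinh s) * P' (cosh s))) has_vector_derivative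
      \<rho> * (\<rho> + 1) * of_real (sinh s) * P (cosh s)) (at s within {0..})" for s
  proof -
    have 1: "((\<lambda>s. complex_of_real (sinh s)) has_vector_derivative of_real (cosh s)) (at s within {0..})"
      by (intro has_vector_derivative_of_real)
         (auto simp flip: has_real_derivative_iff_has_vector_derivative intro!: derivative_eq_intros)
    define C S :: complex where "C = of_real (cosh s)" and "S = of_real (sinh s)"
    have CS: "C ^ 2 = S ^ 2 + 1"
      by (simp add: C_def S_def cosh_square_eq flip: of_real_power)
    have "(1 - C ^ 2) * P'' (cosh s) - 2 * C * P' (cosh s) + \<rho> * (\<rho> + 1) * P (cosh s) = 0"
      using eq[of "cosh s"] by (simp add: C_def cosh_real_ge_1)
    then have eq': "S ^ 2 * P'' (cosh s) + 2 * C * P' (cosh s) = \<rho> * (\<rho> + 1) * P (cosh s)"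
      unfolding CS by (simp add: algebra_simps)
    have "S * (S * (S * P'' (cosh s)) + C * P' (cosh s)) + C * (S * P' (cosh s)) =
        S * (S ^ 2 * P'' (cosh s) + 2 * C * P' (cosh s))"
      by (simp add: algebra_simps power2_eq_square)
    then have "S * (S * (S * P'' (cosh s)) + C * P' (cosh s)) + C * (S * P' (cosh s)) =
        \<rho> * (\<rho> + 1) * S * P (cosh s)"
      unfolding eq' by (simp only: mult_ac)
    then show ?thesis
      unfolding C_def S_def
      by (rule has_vector_derivative_eq_rhs[OF has_vector_derivative_mult[OF 1
            has_vector_derivative_mult[OF 1 cosh[OF P''[OF cosh_real_ge_1]]]]])
  qed
  moreover have "((\<lambda>s. P (cosh s)) has_vector_derivative of_real (sinh s) * P' (cosh s))
      (at s within {0..})" for s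
    by (rule cosh[OF P'[OF cosh_real_ge_1]])
  ultimately show ?thesis
    unfolding radial_eigenfunction_def
    by (intro exI[of _ "\<lambda>s. of_real (sinh s) * P' (cosh s)"]) blast
qed

theorem corollary9:
  fixes \<rho> :: complex and P :: "real \<Rightarrow> complex"
  assumes "legendre_solution \<rho> P"
  shows "\<exists>c :: complex. \<forall>x\<in>{1..}. P x = c * legendre_function \<rho> x"
proof (intro exI ballI)
  fix x :: real assume "x \<in> {1..}"
  then have x: "x = cosh (arcosh x)" "arcosh x \<ge> 0" by auto
  \<comment> \<open>The integral equals \<open>2 * pi\<close> at \<open>s = 0\<close>, so this
    \<open>c\<close> makes the difference vanish there. With the factor \<open>1 / (2 * pi)\<close>
    of \<open>legendre_function\<close> restored, the witness is \<open>P 1\<close>, which does not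
    depend on \<open>x\<close>.\<close>
  define c where "c = P 1 / of_real (2 * pi)"
  have "radial_eigenfunction (\<rho> * (\<rho> + 1)) (\<lambda>s. P (cosh s) - c * laplace_integral \<rho> s)"
    by (intro radial_eigenfunction_diff_scaled radial_eigenfunction_legendre_solution
        radial_eigenfunction_laplace_integral assms)
  then have "P (cosh (arcosh x)) - c * laplace_integral \<rho> (arcosh x) = 0"
    by (rule radial_eigenfunction_eq_0) (auto simp: laplace_integral_0 c_def x(2))
  then show "P x = P 1 * legendre_function \<rho> x"
    using x legendre_function_cosh[OF x(2), of \<rho>] by (simp add: c_def)
qed

end
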